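(* For every integer $n\geq 1$ there exists a $2$-generated polycyclic subgroup $G_n$ of the affine group $\mathbb{A}(\overline{\mathbb{Q}})$ (in particular $G_n$ is a metabelian polycyclic subgroup of $GL_2(\overline{\mathbb{Q}})$) such that $d^{+}_{G_n}\geq n$ and $G_n$ is not virtually nilpotent.
   Context: For a field $K$, $\mathbb{A}(K)=\left\{\begin{pmatrix} a & b\\ 0 & 1\end{pmatrix} : a\in K^{\times}, b\in K\right\}$ is the group of affine transformations $x\mapsto ax+b$ of the $K$-line. Here $\overline{\mathbb{Q}}$ is the field of algebraic numbers. Two elements of a group are positively independent if they freely generate a free semigroup. For a finitely generated group $\Gamma$, let $\mathcal{C}$ be the set of all finite generating subsets $\Sigma$ of $\Gamma$ that are symmetric ($s\in\Sigma\Rightarrow s^{-1}\in\Sigma$) and contain the identity. For $\Sigma\in\mathcal{C}$, $\Sigma^n$ denotes the set of all products of at most $n$ elements of $\Sigma$. Define $d^{+}(\Sigma)=\inf\{n\in\mathbb{N} : \Sigma^n \text{ contains two positively independent elements}\}$ (equal to $+\infty$ if there is no such $n$), and $d^{+}_{\Gamma}=\sup\{d^{+}(\Sigma) : \Sigma\in\mathcal{C}\}$. A group is virtually nilpotent if it has a nilpotent subgroup of finite index. *)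

theory Defs
  imports
    "HOL-Analysis.Analysis"
    "HOL-Algebra.Elementary_Groups"
    "HOL-Algebra.Generated_Groups"
    "HOL-Library.Extended_Nat"
begin

text \<open>
  Fields are given as subfields \<open>K\<close> of an ambient field type, so that \<open>\<A>(K)\<close> is literally
  a group of 2 by 2 matrices inside \<open>GL\<^sub>2(K)\<close>. A subgroup \<open>H\<close> of \<open>G\<close>, viewed as a group in its
  own right, is \<open>G\<lparr>carrier := H\<rparr>\<close>.
\<close>

definition algebraic_numbers :: "complex set" where
  "algebraic_numbers = {z. algebraic z}"

definition GL2 :: "'a::field set \<Rightarrow> ('a^2^2) monoid" where
  "GL2 K = \<lparr>carrier = {A. (\<forall>i j. A $ i $ j \<in> K) \<and> det A \<noteq> 0}, mult = (**), one = mat 1\<rparr>"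

definition affine_group :: "'a::field set \<Rightarrow> ('a^2^2) monoid" where
  "affine_group K =
     \<lparr>carrier = {vector [vector [a, b], vector [0, 1]] | a b. a \<in> K \<and> a \<noteq> 0 \<and> b \<in> K},
      mult = (**), one = mat 1\<rparr>"

definition two_generated :: "('g, 'm) monoid_scheme \<Rightarrow> bool" where
  "two_generated G \<longleftrightarrow> (\<exists>x\<in>carrier G. \<exists>y\<in>carrier G. generate G {x, y} = carrier G)"

definition metabelian :: "('g, 'm) monoid_scheme \<Rightarrow> bool" where
  "metabelian G \<longleftrightarrow> group G \<and> comm_group (G\<lparr>carrier := derived G (carrier G)\<rparr>)"

definition polycyclic :: "('g, 'm) monoid_scheme \<Rightarrow> bool" where
  "polycyclic G \<longleftrightarrow> group G \<and>
     (\<exists>(m::nat) (H :: nat \<Rightarrow> 'g set).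
        H 0 = {\<one>\<^bsub>G\<^esub>} \<and> H m = carrier G \<and>
        (\<forall>i\<le>m. subgroup (H i) G) \<and>
        (\<forall>i<m. H i \<lhd> G\<lparr>carrier := H (Suc i)\<rparr> \<and>
               cyclic_group (G\<lparr>carrier := H (Suc i)\<rparr> Mod H i)))"

primrec lower_central :: "('g, 'm) monoid_scheme \<Rightarrow> nat \<Rightarrow> 'g set" where
  "lower_central G 0 = carrier G"
| "lower_central G (Suc k) =
     generate G {x \<otimes>\<^bsub>G\<^esub> y \<otimes>\<^bsub>G\<^esub> inv\<^bsub>G\<^esub> x \<otimes>\<^bsub>G\<^esub> inv\<^bsub>G\<^esub> y | x y.
                 x \<in> lower_central G k \<and> y \<in> carrier G}"

definition nilpotent_group :: "('g, 'm) monoid_scheme \<Rightarrow> bool" where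
  "nilpotent_group G \<longleftrightarrow> group G \<and> (\<exists>k. lower_central G k = {\<one>\<^bsub>G\<^esub>})"

definition virtually_nilpotent :: "('g, 'm) monoid_scheme \<Rightarrow> bool" where
  "virtually_nilpotent G \<longleftrightarrow>
     (\<exists>H. subgroup H G \<and> finite (rcosets\<^bsub>G\<^esub> H) \<and> nilpotent_group (G\<lparr>carrier := H\<rparr>))"

definition word_prod :: "('g, 'm) monoid_scheme \<Rightarrow> 'g list \<Rightarrow> 'g" where
  "word_prod G ws = foldr (mult G) ws \<one>\<^bsub>G\<^esub>"

text \<open>
  The nonempty words over a two-letter alphabet form the free semigroup of rank two; \<open>x\<close> and \<open>y\<close>
  are positively independent if evaluating these words at \<open>x\<close> and \<open>y\<close> is injective. In particular
  this forces \<open>x \<noteq> y\<close>.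
\<close>

definition positively_independent :: "('g, 'm) monoid_scheme \<Rightarrow> 'g \<Rightarrow> 'g \<Rightarrow> bool" where
  "positively_independent G x y \<longleftrightarrow>
     x \<in> carrier G \<and> y \<in> carrier G \<and>
     inj_on (\<lambda>w :: bool list. word_prod G (map (\<lambda>c. if c then x else y) w)) {w. w \<noteq> []}"

definition symmetric_generating_sets :: "('g, 'm) monoid_scheme \<Rightarrow> 'g set set" where
  "symmetric_generating_sets G =
     {S. S \<subseteq> carrier G \<and> finite S \<and> generate G S = carrier G \<and>
         (\<forall>s\<in>S. inv\<^bsub>G\<^esub> s \<in> S) \<and> \<one>\<^bsub>G\<^esub> \<in> S}"

definition products_upto :: "('g, 'm) monoid_scheme \<Rightarrow> 'g set \<Rightarrow> nat \<Rightarrow> 'g set" where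
  "products_upto G S n = {word_prod G ws | ws. set ws \<subseteq> S \<and> length ws \<le> n}"

text \<open>The infimum of the empty set in \<^typ>\<open>enat\<close> is \<open>\<infinity>\<close>.\<close>

definition d_plus :: "('g, 'm) monoid_scheme \<Rightarrow> 'g set \<Rightarrow> enat" where
  "d_plus G S =
     Inf (enat ` {n. \<exists>x\<in>products_upto G S n. \<exists>y\<in>products_upto G S n. positively_independent G x y})"

definition d_plus_group :: "('g, 'm) monoid_scheme \<Rightarrow> enat" where
  "d_plus_group G = (SUP S\<in>symmetric_generating_sets G. d_plus G S)"

end

theory Submission
  imports Defs
begin

text \<open>
  Write \<open>\<phi>\<close> for the golden ratio, put \<open>N = n!\<close>, and let \<open>l\<close> be a real \<open>N\<close>-th root of \<open>\<phi>\<close>.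
  The group \<open>\<Gamma>\<close> generated by \<open>A: x \<mapsto> l x\<close> and \<open>B: x \<mapsto> x + 1\<close> has the required properties, and
  the generating set consisting of \<open>1\<close>, \<open>A\<close>, \<open>B\<close> and their inverses is a witness for
  \<open>d\<^sup>+ \<ge> n\<close>.

  A product of \<open>m < n\<close> generators is a map \<open>x \<mapsto> l\<^sup>k x + b\<close> with \<open>\<bar>k\<bar> \<le> m < n\<close>. Either \<open>k = 0\<close>, or
  \<open>\<bar>k\<bar>\<close> divides \<open>n!\<close>; in both cases some positive power of the map has the multiplier \<open>1\<close>, \<open>\<phi>\<close> or
  \<open>1/\<phi>\<close>. Positive powers of positively independent elements are again positively independent
  (\<open>positively_independent_powers\<close>), so it suffices that two affine maps with
  multipliers in \<open>{1, \<phi>, 1/\<phi>}\<close> always satisfy a positive relation. Such a relation is an identity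
  between two sums of powers of the multipliers, and the equation \<open>\<phi>\<^sup>2 = \<phi> + 1\<close> supplies one in
  each case (\<open>golden_not_positively_independent\<close>): for instance, if both \<open>x\<close> and \<open>y\<close> have
  multiplier \<open>\<phi>\<close>, then \<open>y y x = x x y\<close>. The point of taking an \<open>N\<close>-th root is that short words
  see only \<open>l\<close>, while the relation lives at the high power \<open>l\<^sup>N\<close>.

  The equation \<open>l\<^sup>2\<^sup>N = l\<^sup>N + 1\<close> shows that \<open>l\<close> is an algebraic unit and that the ring
  \<open>R = \<int>[l, 1/l]\<close> is spanned over \<open>\<int>\<close> by the powers \<open>l\<^sup>i\<close> with \<open>i < 2N\<close>. Hence \<open>\<Gamma>\<close> is the
  semidirect product of the finitely generated abelian group of translations by \<open>R\<close> with the
  cyclic group generated by \<open>A\<close>, which makes it polycyclic, and the elements of \<open>R\<close> are algebraic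
  because \<open>R\<close> spans a finite-dimensional algebra over the rationals. Finally \<open>\<Gamma>\<close> is not virtually
  nilpotent: a subgroup of finite index contains a positive power of \<open>A\<close> and a nonzero translation,
  and the commutator of a translation by \<open>b\<close> with \<open>A\<^sup>j\<close> is the translation by \<open>(1 - l\<^sup>j) b\<close>,
  which is nonzero as \<open>l > 1\<close>.
\<close>

section \<open>Affine maps as matrices\<close>

definition aff :: "'a::field \<Rightarrow> 'a \<Rightarrow> 'a^2^2" where
  "aff a b = vector [vector [a, b], vector [0, 1]]"

lemma aff_nth [simp]:
  "aff a b $ 1 $ 1 = a" "aff a b $ 1 $ 2 = b" "aff a b $ 2 $ 1 = 0" "aff a b $ 2 $ 2 = 1"
  by (simp_all add: aff_def)

lemma aff_eq_iff [simp]: "aff a b = aff c d \<longleftrightarrow> a = c \<and> b = d"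
  by (metis aff_nth(1,2))

lemma aff_mult [simp]: "aff a b ** aff c d = aff (a * c) (a * d + b)"
  by (simp add: vec_eq_iff forall_2 matrix_matrix_mult_def sum_2)

lemma mat_1_eq_aff: "mat 1 = aff 1 0"
  by (simp add: vec_eq_iff forall_2 mat_def)

lemma det_aff: "det (aff a b) = a"
  by (simp add: det_2)

lemma carrier_affine_group:
  "carrier (affine_group K) = {aff a b | a b. a \<in> K \<and> a \<noteq> 0 \<and> b \<in> K}"
  by (simp add: affine_group_def aff_def)

lemma affine_group_simps [simp]:
  "mult (affine_group K) = (**)" "one (affine_group K) = aff 1 0"
  by (simp_all add: affine_group_def mat_1_eq_aff)

text \<open>
  The affine group over a subfield is a subgroup of the one over the whole field, so products,
  inverses and powers can all be computed in the latter.
\<close>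

abbreviation Aff :: "('a::field^2^2) monoid" where
  "Aff \<equiv> affine_group UNIV"

lemma aff_in_Aff [simp]: "aff a b \<in> carrier Aff \<longleftrightarrow> a \<noteq> 0"
  by (auto simp: carrier_affine_group)

lemma Aff_cases: "x \<in> carrier Aff \<Longrightarrow> (\<And>a b. x = aff a b \<Longrightarrow> a \<noteq> 0 \<Longrightarrow> P) \<Longrightarrow> P"
  by (auto simp: carrier_affine_group)

lemma group_Aff: "group (Aff :: ('a::field^2^2) monoid)"
proof (rule groupI)
  fix x :: "'a^2^2"
  assume "x \<in> carrier Aff"
  then obtain a b where x: "x = aff a b" "a \<noteq> 0" by (rule Aff_cases)
  then have "aff (1/a) (- b/a) \<in> carrier Aff \<and> aff (1/a) (- b/a) ** x = aff 1 0" by simp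
  then show "\<exists>y\<in>carrier Aff. y \<otimes>\<^bsub>Aff\<^esub> x = \<one>\<^bsub>Aff\<^esub>" by auto
qed (auto elim!: Aff_cases simp: matrix_mul_assoc)

interpretation Aff: group "Aff :: ('a::field^2^2) monoid"
  rewrites "mult Aff = (**)" and "one Aff = aff 1 0"
  by (simp_all add: group_Aff)

lemma inv_aff:
  assumes "a \<noteq> 0"
  shows "inv\<^bsub>Aff\<^esub> (aff a b) = aff (inverse a) (- b / a)"
  by (rule Aff.inv_equality) (use assms in \<open>auto simp: field_simps\<close>)

lemma aff_nat_pow: "\<exists>c. aff a b [^]\<^bsub>Aff\<^esub> (k::nat) = aff (a ^ k) c"
  by (induction k) (auto simp: mult.commute)

lemma aff_0_nat_pow: "aff a 0 [^]\<^bsub>Aff\<^esub> (k::nat) = aff (a ^ k) 0"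
  by (induction k) (auto simp: mult.commute)

lemma aff_1_nat_pow: "aff 1 b [^]\<^bsub>Aff\<^esub> (k::nat) = aff 1 (of_nat k * b)"
  by (induction k) (auto simp: algebra_simps)

lemma aff_0_int_pow: "a \<noteq> 0 \<Longrightarrow> aff a 0 [^]\<^bsub>Aff\<^esub> (k::int) = aff (a powi k) 0"
  by (cases k rule: int_cases2) (simp_all add: int_pow_int Aff.int_pow_neg_int aff_0_nat_pow inv_aff power_int_minus)

lemma aff_1_int_pow: "aff 1 b [^]\<^bsub>Aff\<^esub> (k::int) = aff 1 (of_int k * b)"
  by (cases k rule: int_cases2) (simp_all add: int_pow_int Aff.int_pow_neg_int aff_1_nat_pow inv_aff)

text \<open>
  Inverses in a set of matrices are unique already because matrix multiplication is associative.
  Closure under inverses is therefore a statement about matrices alone, and one criterion serves the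
  affine and the general linear groups over any set of entries.
\<close>

lemma subgroup_of_matrix_monoidI:
  fixes M :: "('a::field^2^2) monoid"
  assumes M: "mult M = (**)" "one M = mat 1" and H: "H \<subseteq> carrier M" "mat 1 \<in> H"
    and mult: "\<And>x y. x \<in> H \<Longrightarrow> y \<in> H \<Longrightarrow> x ** y \<in> H"
    and inv: "\<And>x. x \<in> H \<Longrightarrow> \<exists>y\<in>H. x ** y = mat 1 \<and> y ** x = mat 1"
  shows "subgroup H M"
proof
  fix x assume x: "x \<in> H"
  then obtain y where y: "y \<in> H" "x ** y = mat 1" "y ** x = mat 1" using inv by blast
  have "z = y" if "z ** x = mat 1" for z
  proof -
    have "z = z ** (x ** y)" using y by simp
    also have "\<dots> = y" using that by (simp add: matrix_mul_assoc)
    finally show ?thesis .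
  qed
  then have "inv\<^bsub>M\<^esub> x = y"
    unfolding m_inv_def M using y H by (intro the_equality) blast+
  then show "inv\<^bsub>M\<^esub> x \<in> H" using y by simp
qed (use assms in auto)

section \<open>Words and positive independence\<close>

lemma (in group) word_prod_append:
  assumes "set u \<subseteq> carrier G" "set v \<subseteq> carrier G"
  shows "word_prod G (u @ v) = word_prod G u \<otimes> word_prod G v"
    and "word_prod G u \<in> carrier G"
proof -
  have closed: "word_prod G w \<in> carrier G" if "set w \<subseteq> carrier G" for w
    using that by (induction w) (auto simp: word_prod_def)
  show "word_prod G u \<in> carrier G" using closed assms by simp
  show "word_prod G (u @ v) = word_prod G u \<otimes> word_prod G v"
    using assms
  proof (induction u)
    case Nil
    then show ?case using closed[of v] by (simp add: word_prod_def)
  next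
    case (Cons a u)
    then have "word_prod G (a # u @ v) = a \<otimes> (word_prod G u \<otimes> word_prod G v)"
      by (simp add: word_prod_def)
    then show ?case using Cons.prems closed[of u] closed[of v] by (simp add: word_prod_def m_assoc)
  qed
qed

lemma (in group) word_prod_replicate:
  assumes "x \<in> carrier G"
  shows "word_prod G (replicate p x) = x [^] p"
proof (induction p)
  case (Suc p)
  then show ?case using nat_pow_mult[of x 1 p] assms by (simp add: word_prod_def)
qed (simp add: word_prod_def)

lemma word_prod_restrict [simp]: "word_prod (G\<lparr>carrier := H\<rparr>) = word_prod G"
  by (simp add: word_prod_def fun_eq_iff)

text \<open>
  Substitution of \<open>x\<^sup>p\<close> and \<open>y\<^sup>q\<close> for the two letters, \<^term>\<open>True\<close> standing for \<open>x\<close> and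
  \<^term>\<open>False\<close> for \<open>y\<close>.
\<close>

definition expand :: "nat \<Rightarrow> nat \<Rightarrow> bool list \<Rightarrow> bool list" where
  "expand p q w = concat (map (\<lambda>c. replicate (if c then p else q) c) w)"

lemma expand_eq_Nil: "p > 0 \<Longrightarrow> q > 0 \<Longrightarrow> expand p q w = [] \<longleftrightarrow> w = []"
  by (cases w) (auto simp: expand_def)

text \<open>
  The images of the two letters start with different letters, so a word can be recovered from its
  expansion by reading from left to right.
\<close>

lemma inj_expand:
  assumes "p > 0" "q > 0"
  shows "inj (expand p q)"
proof (rule injI)
  fix u v
  show "expand p q u = expand p q v \<Longrightarrow> u = v"
  proof (induction u arbitrary: v)
    case Nil
    then show ?case using expand_eq_Nil[OF assms, of v] by (simp add: expand_def)
  next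
    case (Cons c u)
    then have "v \<noteq> []" using expand_eq_Nil[OF assms, of "c # u"] by (auto simp: expand_def)
    then obtain d v' where v: "v = d # v'" by (cases v) auto
    have hd: "hd (expand p q (e # w)) = e" for e w
      using assms by (auto simp: expand_def gr0_conv_Suc)
    have "c = d" using Cons.prems hd v by metis
    moreover from this have "expand p q u = expand p q v'"
      using Cons.prems v by (simp add: expand_def)
    ultimately show ?case using Cons.IH v by simp
  qed
qed

text \<open>
  A word in the powers is an expanded word in the original elements, and expansion of words is
  injective.
\<close>

lemma (in group) positively_independent_powers:
  assumes pi: "positively_independent G x y" and pq: "p > 0" "q > 0"
  shows "positively_independent G (x [^] (p::nat)) (y [^] (q::nat))"
proof -
  let ?ev = "\<lambda>x y (w :: bool list). word_prod G (map (\<lambda>c. if c then x else y) w)"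
  have xy: "x \<in> carrier G" "y \<in> carrier G" using pi by (auto simp: positively_independent_def)
  have ev: "?ev (x [^] p) (y [^] q) w = ?ev x y (expand p q w)" for w
  proof (induction w)
    case (Cons c w)
    have "?ev x y (expand p q (c # w)) =
        word_prod G (replicate (if c then p else q) (if c then x else y)) \<otimes> ?ev x y (expand p q w)"
      using xy by (subst word_prod_append(1)[symmetric]) (auto simp: expand_def)
    then show ?case using Cons xy by (simp add: word_prod_replicate) (simp add: word_prod_def)
  qed (simp add: expand_def word_prod_def)
  have "inj_on (?ev x y \<circ> expand p q) {w. w \<noteq> []}"
    by (rule comp_inj_on)
      (use pi expand_eq_Nil[OF pq] in \<open>auto simp: positively_independent_def
         intro: inj_on_subset[OF inj_expand[OF pq]] elim!: inj_on_subset\<close>)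
  then show ?thesis
    using xy by (simp add: positively_independent_def ev o_def)
qed

lemma not_positively_independentI:
  assumes "word_prod G (map (\<lambda>c. if c then x else y) u) =
           word_prod G (map (\<lambda>c. if c then x else y) v)"
    and "u \<noteq> v" "u \<noteq> []" "v \<noteq> []"
  shows "\<not> positively_independent G x y"
  using assms unfolding positively_independent_def by (auto dest: inj_onD)

text \<open>
  A word \<open>w\<^sub>1 w\<^sub>2 \<dots>\<close> in affine maps translates by the sum of the translation parts of its letters,
  each weighted by the product of the multipliers of the preceding letters. With
  \<open>L\<^sup>2 = L + 1\<close> and hence \<open>1/L = L - 1\<close>, the relations used for \<open>x\<close> and \<open>y\<close>, up to exchanging the two,
  are the following.
  \<^item> Multipliers \<open>1, 1\<close>: \<open>x y = y x\<close>.
  \<^item> Multipliers \<open>1, L\<close>: \<open>x y x y = y y x\<close>, since \<open>1 + L = L\<^sup>2\<close>.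
  \<^item> Multipliers \<open>1, 1/L\<close>: \<open>x y y = y x y x\<close>, since \<open>1 = 1/L + 1/L\<^sup>2\<close>.
  \<^item> Multipliers \<open>L, L\<close>: \<open>y y x = x x y\<close>.
  \<^item> Multipliers \<open>1/L, 1/L\<close>: \<open>x y y = y x x\<close>.
  \<^item> Multipliers \<open>L, 1/L\<close>: \<open>(x y) (y x) = (y x) (x y)\<close>, since \<open>x y\<close> and \<open>y x\<close> are translations.
\<close>

lemma golden_not_positively_independent:
  fixes L :: "'a::field"
  assumes L: "L\<^sup>2 = L + 1" and a: "a \<in> {1, L, inverse L}" and b: "b \<in> {1, L, inverse L}"
  shows "\<not> positively_independent Aff (aff a s) (aff b t)"
proof -
  have LL: "L * L = L + 1" "L * (L * z) = L * z + z" for z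
    using L by (simp_all add: power2_eq_square distrib_right flip: mult.assoc)
  have "inverse L = L - 1"
    by (rule inverse_unique) (simp add: LL algebra_simps)
  then consider "a = 1" "b = 1" | "a = 1" "b = L" | "a = L" "b = 1" | "a = 1" "b = L - 1"
    | "a = L - 1" "b = 1" | "a = L" "b = L" | "a = L - 1" "b = L - 1"
    | "a = L" "b = L - 1" | "a = L - 1" "b = L"
    using a b by auto
  then show ?thesis
  proof cases
    case 1 show ?thesis unfolding 1
      by (rule not_positively_independentI[of _ _ _ "[True, False]" "[False, True]"])
        (auto simp: word_prod_def LL algebra_simps)
  next
    case 2 show ?thesis unfolding 2
      by (rule not_positively_independentI[of _ _ _ "[True,False,True,False]" "[False,False,True]"])
        (auto simp: word_prod_def LL algebra_simps)
  next
    case 3 show ?thesis unfolding 3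
      by (rule not_positively_independentI[of _ _ _ "[False,True,False,True]" "[True,True,False]"])
        (auto simp: word_prod_def LL algebra_simps)
  next
    case 4 show ?thesis unfolding 4
      by (rule not_positively_independentI[of _ _ _ "[True,False,False]" "[False,True,False,True]"])
        (auto simp: word_prod_def LL algebra_simps)
  next
    case 5 show ?thesis unfolding 5
      by (rule not_positively_independentI[of _ _ _ "[False,True,True]" "[True,False,True,False]"])
        (auto simp: word_prod_def LL algebra_simps)
  next
    case 6 show ?thesis unfolding 6
      by (rule not_positively_independentI[of _ _ _ "[False,False,True]" "[True,True,False]"])
        (auto simp: word_prod_def LL algebra_simps)
  next
    case 7 show ?thesis unfolding 7
      by (rule not_positively_independentI[of _ _ _ "[True,False,False]" "[False,True,True]"])
        (auto simp: word_prod_def LL algebra_simps)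
  next
    case 8 show ?thesis unfolding 8
      by (rule not_positively_independentI[of _ _ _ "[True,False,False,True]" "[False,True,True,False]"])
        (auto simp: word_prod_def LL algebra_simps)
  next
    case 9 show ?thesis unfolding 9
      by (rule not_positively_independentI[of _ _ _ "[True,False,False,True]" "[False,True,True,False]"])
        (auto simp: word_prod_def LL algebra_simps)
  qed
qed

section \<open>Algebraicity from finite dimension\<close>

text \<open>
  If the powers of \<open>x\<close> lie in a rational vector space of finite dimension \<open>d\<close>, then \<open>1, x, \<dots>, x\<^sup>d\<close> are
  linearly dependent, and a dependency is a rational polynomial with the root \<open>x\<close>.
\<close>

lemma algebraic_if_powers_in_finite_span:
  fixes x :: "'a::field_char_0"
  assumes B: "finite B"
    and pow: "\<And>i. x ^ i \<in> module.span (\<lambda>(q::rat) z. of_rat q * z) B"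
  shows "algebraic x"
\<comment> \<open>Linear dependence of a set cannot see repeated elements, so coinciding powers are treated separately.\<close>
proof (cases "inj (\<lambda>i::nat. x ^ i)")
  case False
  then obtain i j where ij: "x ^ i = x ^ j" "i \<noteq> j" by (auto simp: inj_def)
  let ?p = "monom 1 i - monom 1 j :: 'a poly"
  have "coeff ?p i \<noteq> 0" using ij by simp
  then have "?p \<noteq> 0" by fastforce
  then show ?thesis using ij by (intro algebraicI[of ?p]) (auto simp: poly_monom)
next
  case True
  interpret Q: vector_space "\<lambda>(q::rat) (z::'a). of_rat q * z"
    by unfold_locales (auto simp: algebra_simps of_rat_add of_rat_mult)
  let ?S = "(\<lambda>i. x ^ i) ` {..card B}"
  have inj: "inj_on (\<lambda>i. x ^ i) {..card B}" using True by (rule inj_on_subset) auto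
  have "Q.dependent ?S"
  proof (rule ccontr)
    assume "\<not> Q.dependent ?S"
    then have "card ?S \<le> card B"
      using Q.independent_span_bound[OF B] pow by blast
    then show False using card_image[OF inj] by simp
  qed
  then obtain u v where v: "v \<in> ?S" "u v \<noteq> 0" and u: "(\<Sum>v\<in>?S. of_rat (u v) * v) = 0"
    by (auto simp: Q.dependent_finite)
  let ?p = "\<Sum>i\<le>card B. monom (of_rat (u (x ^ i))) i :: 'a poly"
  have coeff: "coeff ?p i = (if i \<le> card B then of_rat (u (x ^ i)) else 0)" for i
    by (simp add: coeff_sum)
  have "poly ?p x = 0"
    using u by (simp add: poly_sum poly_monom sum.reindex[OF inj])
  moreover have "?p \<noteq> 0"
    using v coeff by (metis (no_types, lifting) atMost_iff coeff_0 imageE of_rat_eq_0_iff)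
  ultimately show ?thesis
    by (intro algebraicI'[of ?p]) (auto simp: coeff)
qed

section \<open>General facts on groups\<close>

lemma (in group) cyclic_group_FactGroupI:
  assumes K: "K \<lhd> G" and g: "g \<in> carrier G"
    and gen: "\<And>x. x \<in> carrier G \<Longrightarrow> \<exists>h\<in>K. \<exists>n::int. x = h \<otimes> g [^] n"
  shows "cyclic_group (G Mod K)"
proof -
  interpret K: normal K G by fact
  interpret Q: group "G Mod K" by (rule K.factorgroup_is_group)
  have pow: "(K #> g) [^]\<^bsub>G Mod K\<^esub> n = K #> g [^] n" for n :: int
    using g by (rule K.FactGroup_int_pow)
  have "K #> x \<in> range (\<lambda>n::int. K #> g [^] n)" if x: "x \<in> carrier G" for x
  proof -
    obtain h and n :: int where h: "h \<in> K" "x = h \<otimes> g [^] n" using gen[OF x] by blast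
    then have "x \<in> K #> g [^] n" using g K.subset by (auto intro!: rcosI)
    then show ?thesis using g repr_independence[OF _ _ K.subgroup_axioms] by blast
  qed
  then show ?thesis
    unfolding Q.cyclic_group using g
    by (intro bexI[of _ "K #> g"]) (auto simp: pow carrier_FactGroup)
qed

text \<open>
  Among the cosets of the powers of \<open>x\<close> two coincide, and the corresponding quotient of powers lies
  in the subgroup.
\<close>

lemma (in group) finite_index_imp_power_mem:
  assumes H: "subgroup H G" and fin: "finite (rcosets H)" and x: "x \<in> carrier G"
  obtains j :: nat where "j > 0" "x [^] j \<in> H"
proof -
  have "(\<lambda>i::nat. H #> x [^] i) ` UNIV \<subseteq> rcosets H"
    using x H by (auto intro!: rcosetsI dest: subgroup.subset)
  then have "\<not> inj (\<lambda>i::nat. H #> x [^] i)"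
    using fin by (metis finite_imageD finite_subset infinite_UNIV_nat)
  then obtain i j :: nat where ij: "i < j" "H #> x [^] i = H #> x [^] j"
    unfolding inj_def by (metis linorder_neqE_nat)
  then have "x [^] j \<in> H #> x [^] i" using rcos_self[OF _ H] x by simp
  then have "x [^] j \<otimes> inv (x [^] i) \<in> H"
    using subgroup.rcos_module_imp[OF H is_group] x by simp
  moreover have "x [^] j = x [^] (j - i) \<otimes> x [^] i"
    using nat_pow_mult[OF x, of "j - i" i] ij by simp
  ultimately have "x [^] (j - i) \<in> H" using x by (simp add: m_assoc)
  then show ?thesis using that[of "j - i"] ij by simp
qed

lemma lower_central_SucI:
  assumes "x \<in> lower_central G k" "y \<in> carrier G"
  shows "x \<otimes>\<^bsub>G\<^esub> y \<otimes>\<^bsub>G\<^esub> inv\<^bsub>G\<^esub> x \<otimes>\<^bsub>G\<^esub> inv\<^bsub>G\<^esub> y \<in> lower_central G (Suc k)"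
  using assms by (auto intro!: generate.incl)

text \<open>
  One step of a polycyclic series inside an ambient group: every element of \<open>M\<close> is a power of \<open>g\<close>
  modulo \<open>K\<close>, with all conditions stated in the operations of the ambient group.
\<close>

lemma (in group) polycyclic_stepI:
  assumes K: "subgroup K G" and M: "subgroup M G" and KM: "K \<subseteq> M"
    and conj: "\<And>x h. x \<in> M \<Longrightarrow> h \<in> K \<Longrightarrow> x \<otimes> h \<otimes> inv x \<in> K"
    and g: "g \<in> M" and gen: "\<And>x. x \<in> M \<Longrightarrow> \<exists>h\<in>K. \<exists>n::int. x = h \<otimes> g [^] n"
  shows "K \<lhd> G\<lparr>carrier := M\<rparr> \<and> cyclic_group (G\<lparr>carrier := M\<rparr> Mod K)"
proof
  interpret M: group "G\<lparr>carrier := M\<rparr>" using subgroup.subgroup_is_group[OF M] is_group .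
  show normal: "K \<lhd> G\<lparr>carrier := M\<rparr>"
    unfolding M.normal_inv_iff using conj K M KM by (simp add: subgroup_incl)
  show "cyclic_group (G\<lparr>carrier := M\<rparr> Mod K)"
    using g gen int_pow_consistent[OF M g] by (intro M.cyclic_group_FactGroupI[OF normal, of g]) auto
qed

text \<open>
  Taking the multiplier is a homomorphism to an abelian group, so all commutators are translations,
  and translations commute.
\<close>

lemma metabelian_subgroup_Aff:
  assumes "subgroup H (Aff :: ('a::field^2^2) monoid)"
  shows "metabelian ((Aff :: ('a^2^2) monoid)\<lparr>carrier := H\<rparr>)"
proof -
  let ?T = "range (aff (1::'a))" and ?\<Gamma> = "(Aff :: ('a^2^2) monoid)\<lparr>carrier := H\<rparr>"
  interpret H: group ?\<Gamma> using subgroup.subgroup_is_group[OF assms group_Aff] .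
  have T: "subgroup ?T Aff"
    by (rule Aff.subgroupI) (auto simp: inv_aff)
  have "derived_set Aff (carrier Aff) \<subseteq> ?T"
    by (auto elim!: Aff_cases simp: inv_aff image_iff) (simp add: field_simps)
  then have "derived Aff (carrier Aff) \<subseteq> ?T"
    unfolding derived_def by (rule Aff.generate_subgroup_incl[OF _ T])
  then have sub: "derived ?\<Gamma> H \<subseteq> ?T"
    using Aff.derived_consistent[OF subset_refl assms] Aff.mono_derived[OF subgroup.subset[OF assms]]
    by blast
  have "subgroup (derived ?\<Gamma> H) ?\<Gamma>" using H.derived_is_subgroup[of H] by simp
  then have grp: "group (?\<Gamma>\<lparr>carrier := derived ?\<Gamma> H\<rparr>)"
    using H.is_group by (rule subgroup.subgroup_is_group)
  have "comm_group (?\<Gamma>\<lparr>carrier := derived ?\<Gamma> H\<rparr>)"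
  proof (rule group.group_comm_groupI[OF grp])
    fix x y
    assume "x \<in> carrier (?\<Gamma>\<lparr>carrier := derived ?\<Gamma> H\<rparr>)" "y \<in> carrier (?\<Gamma>\<lparr>carrier := derived ?\<Gamma> H\<rparr>)"
    then have "x \<in> ?T" "y \<in> ?T" using sub by auto
    then show "x \<otimes>\<^bsub>?\<Gamma>\<lparr>carrier := derived ?\<Gamma> H\<rparr>\<^esub> y = y \<otimes>\<^bsub>?\<Gamma>\<lparr>carrier := derived ?\<Gamma> H\<rparr>\<^esub> x"
      by (auto simp: add.commute)
  qed
  then show ?thesis by (simp add: metabelian_def H.is_group)
qed

section \<open>Integer spans of powers\<close>

text \<open>
  The spans are indexed by the number \<open>m\<close> of powers, since they increase with \<open>m\<close> by one cyclic
  generator at a time; this gives the polycyclic series of the translations.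
\<close>

definition int_span :: "'a::comm_ring_1 \<Rightarrow> nat \<Rightarrow> 'a set" where
  "int_span l m = range (\<lambda>c::nat \<Rightarrow> int. \<Sum>i<m. of_int (c i) * l ^ i)"

lemma int_span_add: "x \<in> int_span l m \<Longrightarrow> y \<in> int_span l m \<Longrightarrow> x + y \<in> int_span l m"
proof (clarsimp simp: int_span_def)
  fix c d :: "nat \<Rightarrow> int"
  show "(\<Sum>i<m. of_int (c i) * l ^ i) + (\<Sum>i<m. of_int (d i) * l ^ i)
      \<in> range (\<lambda>c. \<Sum>i<m. of_int (c i) * l ^ i)"
    by (rule range_eqI[of _ _ "\<lambda>i. c i + d i"]) (simp add: sum.distrib distrib_right)
qed

lemma int_span_scale: "x \<in> int_span l m \<Longrightarrow> of_int k * x \<in> int_span l m"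
proof (clarsimp simp: int_span_def)
  fix c :: "nat \<Rightarrow> int"
  show "of_int k * (\<Sum>i<m. of_int (c i) * l ^ i) \<in> range (\<lambda>c. \<Sum>i<m. of_int (c i) * l ^ i)"
    by (rule range_eqI[of _ _ "\<lambda>i. k * c i"]) (simp add: sum_distrib_left mult.assoc)
qed

lemma int_span_0: "0 \<in> int_span l m"
  unfolding int_span_def by (rule range_eqI[of _ _ "\<lambda>_. 0"]) simp

lemma int_span_uminus: "x \<in> int_span l m \<Longrightarrow> - x \<in> int_span l m"
  using int_span_scale[of x l m "-1"] by simp

lemma int_span_power: "i < m \<Longrightarrow> l ^ i \<in> int_span l m"
  unfolding int_span_def
  by (rule range_eqI[of _ _ "\<lambda>j. if j = i then 1 else 0"]) (simp add: if_distrib if_distribR sum.delta cong: if_cong)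

lemma int_span_sum: "(\<And>i. i \<in> I \<Longrightarrow> f i \<in> int_span l m) \<Longrightarrow> sum f I \<in> int_span l m"
  by (induction I rule: infinite_finite_induct) (auto simp: int_span_0 int_span_add)

lemma int_span_Suc:
  "x \<in> int_span l (Suc m) \<longleftrightarrow> (\<exists>y\<in>int_span l m. \<exists>k. x = y + of_int k * l ^ m)"
proof
  assume "x \<in> int_span l (Suc m)"
  then show "\<exists>y\<in>int_span l m. \<exists>k. x = y + of_int k * l ^ m"
    by (auto simp: int_span_def)
next
  assume "\<exists>y\<in>int_span l m. \<exists>k. x = y + of_int k * l ^ m"
  then obtain c k where x: "x = (\<Sum>i<m. of_int (c i) * l ^ i) + of_int k * l ^ m"
    by (auto simp: int_span_def)
  show "x \<in> int_span l (Suc m)"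
    unfolding int_span_def x by (rule range_eqI[of _ _ "c(m := k)"]) simp
qed

lemma int_span_induct_mult:
  assumes "\<And>i. i < m \<Longrightarrow> a * l ^ i \<in> int_span l m" and x: "x \<in> int_span l m"
  shows "a * x \<in> int_span l m"
proof -
  obtain c where x: "x = (\<Sum>i<m. of_int (c i) * l ^ i)"
    using x by (auto simp: int_span_def)
  have "a * x = (\<Sum>i<m. of_int (c i) * (a * l ^ i))"
    by (simp add: x sum_distrib_left mult.left_commute)
  then show ?thesis using assms(1) by (auto intro!: int_span_sum int_span_scale)
qed

section \<open>The group generated by a root of the golden ratio\<close>

locale golden_root =
  fixes l :: complex and N :: nat
  assumes N_pos: "N > 0" and golden: "l ^ (2 * N) = l ^ N + 1" and norm_gt_1: "norm l > 1"
begin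

abbreviation R :: "complex set" where
  "R \<equiv> int_span l (2 * N)"

definition H :: "(complex^2^2) set" where
  "H = {aff (l powi k) b | k b. b \<in> R}"

abbreviation \<Gamma> :: "(complex^2^2) monoid" where
  "\<Gamma> \<equiv> Aff\<lparr>carrier := H\<rparr>"

lemma l_nonzero [simp]: "l \<noteq> 0"
  using norm_gt_1 by auto

lemma l_power_neq_1: "j > 0 \<Longrightarrow> l ^ j \<noteq> 1"
  using one_less_power[OF norm_gt_1, of j] by (auto simp flip: norm_power)

text \<open>
  The equation for \<open>l\<close> expresses both \<open>l\<^sup>2\<^sup>N\<close> and \<open>1/l\<close> in the powers \<open>1, l, \<dots>, l\<^sup>2\<^sup>N\<^sup>-\<^sup>1\<close>: it reads
  \<open>l\<^sup>2\<^sup>N = l\<^sup>N + 1\<close> or, divided by \<open>l\<close>, \<open>1/l = l\<^sup>2\<^sup>N\<^sup>-\<^sup>1 - l\<^sup>N\<^sup>-\<^sup>1\<close>. Hence \<open>R\<close> is closed under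
  multiplication by \<open>l\<close> and by its inverse.
\<close>

lemma R_mult_l: "x \<in> R \<Longrightarrow> l * x \<in> R"
proof (rule int_span_induct_mult)
  fix i assume i: "i < 2 * N"
  show "l * l ^ i \<in> R"
  proof (cases "Suc i = 2 * N")
    case True
    then have "l * l ^ i = l ^ N + l ^ 0" using golden by (metis power_0 power_Suc)
    then show ?thesis using N_pos by (simp only:) (intro int_span_add int_span_power; simp)
  next
    case False
    then show ?thesis using int_span_power[of "Suc i" "2 * N" l] i by simp
  qed
qed

lemma R_mult_inverse_l: "x \<in> R \<Longrightarrow> inverse l * x \<in> R"
proof (rule int_span_induct_mult)
  fix i assume i: "i < 2 * N"
  show "inverse l * l ^ i \<in> R"
  proof (cases i)
    case 0
    have "l ^ (2 * N) = l * l ^ (2 * N - 1)" "l ^ N = l * l ^ (N - 1)"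
      using N_pos by (simp_all flip: power_Suc)
    then have "inverse l * l ^ i = l ^ (2 * N - 1) + - (l ^ (N - 1))"
      using golden 0 by (simp add: field_simps)
    then show ?thesis
      using N_pos by (simp only:) (intro int_span_add int_span_uminus int_span_power; simp)
  next
    case (Suc j)
    then show ?thesis using int_span_power[of j "2 * N" l] i by (simp flip: mult.assoc)
  qed
qed

lemma R_mult_powi: "x \<in> R \<Longrightarrow> l powi k * x \<in> R"
proof (induction k rule: int_induct[where k = 0])
  case (step1 i)
  then show ?case using R_mult_l[of "l powi i * x"] by (simp add: power_int_add_1' mult.assoc)
next
  case (step2 i)
  then show ?case using R_mult_inverse_l[of "l powi i * x"]
    by (simp add: power_int_diff field_simps)
qed simp

lemma R_mult_powi_right: "x \<in> R \<Longrightarrow> x * l powi k \<in> R"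
  using R_mult_powi by (simp add: mult.commute)

lemma one_in_R: "1 \<in> R"
  using int_span_power[of 0 "2 * N" l] N_pos by simp

lemma R_mult: "x \<in> R \<Longrightarrow> y \<in> R \<Longrightarrow> x * y \<in> R"
  by (rule int_span_induct_mult)
    (use R_mult_powi_right[of _ "int _"] in auto)

lemma powi_in_R: "l powi k \<in> R"
  using R_mult_powi[OF one_in_R] by simp

lemma algebraic_R:
  assumes "x \<in> R"
  shows "algebraic x"
proof (rule algebraic_if_powers_in_finite_span)
  interpret Q: vector_space "\<lambda>(q::rat) (z::complex). of_rat q * z"
    by unfold_locales (auto simp: algebra_simps of_rat_add of_rat_mult)
  let ?B = "(\<lambda>i. l ^ i) ` {..<2 * N}"
  show "finite ?B" by simp
  fix i
  have "x ^ i \<in> R" by (induction i) (auto simp: one_in_R R_mult assms)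
  moreover have "R \<subseteq> Q.span ?B"
  proof
    fix y assume "y \<in> R"
    then obtain c :: "nat \<Rightarrow> int" where "y = (\<Sum>i<2*N. of_rat (of_int (c i)) * l ^ i)"
      by (auto simp: int_span_def)
    then show "y \<in> Q.span ?B"
      by (simp only:) (rule Q.span_sum, rule Q.span_scale, rule Q.span_base, simp)
  qed
  ultimately show "x ^ i \<in> Q.span ?B" by blast
qed

lemma HI: "b \<in> R \<Longrightarrow> aff (l powi k) b \<in> H"
  by (auto simp: H_def)

lemma translation_in_H: "b \<in> R \<Longrightarrow> aff 1 b \<in> H"
  using HI[of b 0] by simp

lemma subgroup_H:
  fixes M :: "(complex^2^2) monoid"
  assumes "mult M = (**)" "one M = mat 1" "H \<subseteq> carrier M"
  shows "subgroup H M"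
proof (rule subgroup_of_matrix_monoidI[OF assms])
  show "mat 1 \<in> H" by (simp add: mat_1_eq_aff translation_in_H int_span_0)
next
  fix x y assume "x \<in> H" "y \<in> H"
  then obtain k b j c where "x = aff (l powi k) b" "y = aff (l powi j) c" "b \<in> R" "c \<in> R"
    by (auto simp: H_def)
  then have "x ** y = aff (l powi (k + j)) (l powi k * c + b)" "l powi k * c + b \<in> R"
    by (auto simp: power_int_add intro: int_span_add R_mult_powi)
  then show "x ** y \<in> H" by (simp add: HI)
next
  fix x assume "x \<in> H"
  then obtain k b where x: "x = aff (l powi k) b" "b \<in> R" by (auto simp: H_def)
  let ?y = "aff (l powi (- k)) (- (l powi (- k) * b))"
  have "?y \<in> H" using x by (intro HI int_span_uminus R_mult_powi)
  moreover have "x ** ?y = mat 1" "?y ** x = mat 1"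
    by (simp_all add: x mat_1_eq_aff power_int_minus)
  ultimately show "\<exists>y\<in>H. x ** y = mat 1 \<and> y ** x = mat 1" by blast
qed

lemma subgroup_H_Aff: "subgroup H Aff"
  by (rule subgroup_H) (auto simp: mat_1_eq_aff H_def)

lemma subgroup_H_algebraic:
  "subgroup H (affine_group algebraic_numbers)" "subgroup H (GL2 algebraic_numbers)"
  by (rule subgroup_H; auto simp: mat_1_eq_aff H_def carrier_affine_group GL2_def det_aff
      forall_2 algebraic_numbers_def algebraic_R powi_in_R)+

sublocale \<Gamma>: group \<Gamma>
  using subgroup.subgroup_is_group[OF subgroup_H_Aff group_Aff] .

text \<open>
  Conjugating the translation by an integer \<open>k\<close> with \<open>A\<^sup>i\<close> gives the translation by \<open>k l\<^sup>i\<close>; sums of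
  these exhaust \<open>R\<close>.
\<close>

lemma generate_eq_H:
  assumes S: "S \<subseteq> H" "aff l 0 \<in> S" "aff 1 1 \<in> S"
  shows "generate \<Gamma> S = H"
proof -
  let ?K = "generate Aff S"
  have S_Aff: "S \<subseteq> carrier Aff" using S subgroup.subset[OF subgroup_H_Aff] by blast
  have K: "subgroup ?K Aff" using Aff.generate_is_subgroup[OF S_Aff] .
  have A: "aff (l powi k) 0 \<in> ?K" for k
    using Aff.subgroup_int_pow_closed[OF K generate.incl[OF S(2)], of k] by (simp add: aff_0_int_pow)
  have B: "aff 1 (of_int k) \<in> ?K" for k :: int
    using Aff.subgroup_int_pow_closed[OF K generate.incl[OF S(3)], of k] by (simp add: aff_1_int_pow)
  note closed = subgroup.m_closed[OF K, simplified]
  have monomial: "aff 1 (of_int k * l ^ i) \<in> ?K" for k i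
    using closed[OF closed[OF A[of "int i"] B[of k]] A[of "- int i"]]
    by (simp add: power_int_minus mult.commute)
  have trans: "b \<in> int_span l m \<Longrightarrow> aff 1 b \<in> ?K" for b m
  proof (induction m arbitrary: b)
    case 0
    then show ?case using A[of 0] by (simp add: int_span_def)
  next
    case (Suc m)
    then obtain y k where "aff 1 y \<in> ?K" "b = y + of_int k * l ^ m" by (auto simp: int_span_Suc)
    then show ?case using closed[OF monomial[of k m]] by fastforce
  qed
  have "H \<subseteq> ?K"
    using closed[OF trans A] by (fastforce simp: H_def)
  moreover have "generate \<Gamma> S = ?K"
    using Aff.generate_consistent[OF S(1) subgroup_H_Aff] by simp
  moreover have "generate \<Gamma> S \<subseteq> H" using \<Gamma>.generate_incl[of S] S by simp
  ultimately show ?thesis by blast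
qed

lemma generators_in_H: "aff l 0 \<in> H" "aff (inverse l) 0 \<in> H" "aff 1 1 \<in> H" "aff 1 (-1) \<in> H"
  using HI[OF int_span_0, of 1] HI[OF int_span_0, of "-1"] translation_in_H[OF one_in_R]
    translation_in_H[OF int_span_uminus[OF one_in_R]] by (simp_all add: power_int_minus)

lemma two_generated_\<Gamma>: "two_generated \<Gamma>"
proof -
  have "generate \<Gamma> {aff l 0, aff 1 1} = H"
    using generators_in_H by (intro generate_eq_H) auto
  then show ?thesis
    unfolding two_generated_def using generators_in_H
    by (intro bexI[of _ "aff l 0"] bexI[of _ "aff 1 1"]) simp_all
qed

text \<open>
  The series adds the powers \<open>l\<^sup>0, \<dots>, l\<^sup>2\<^sup>N\<^sup>-\<^sup>1\<close> to the translations one at a time, and the dilation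
  \<open>A\<close> in the last step.
\<close>

lemma polycyclic_\<Gamma>: "polycyclic \<Gamma>"
proof -
  define T where "T m = aff 1 ` int_span l m" for m
  define F where "F i = (if i \<le> 2 * N then T i else H)" for i
  have T: "subgroup (T m) Aff" for m
    using int_span_0[of l m]
    by (intro Aff.subgroupI)
      (auto simp: T_def inv_aff add.commute intro: int_span_add int_span_uminus)
  have F: "subgroup (F i) Aff" for i using T subgroup_H_Aff by (simp add: F_def)
  have FH: "F i \<subseteq> H" for i
  proof (cases "i \<le> 2 * N")
    case True
    have "int_span l i \<subseteq> R"
    proof
      fix x assume "x \<in> int_span l i"
      then show "x \<in> R" using True
        by (auto simp: int_span_def[of l i] intro!: int_span_sum int_span_scale int_span_power)
    qed
    then show ?thesis using True translation_in_H by (auto simp: F_def T_def)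
  qed (simp add: F_def)
  have step: "F i \<lhd> Aff\<lparr>carrier := F (Suc i)\<rparr> \<and> cyclic_group (Aff\<lparr>carrier := F (Suc i)\<rparr> Mod F i)"
    if i: "i \<le> 2 * N" for i
  proof (cases "i = 2 * N")
    case True
    have "T (2 * N) \<lhd> Aff\<lparr>carrier := H\<rparr> \<and> cyclic_group (Aff\<lparr>carrier := H\<rparr> Mod T (2 * N))"
    proof (rule Aff.polycyclic_stepI[OF T subgroup_H_Aff, of _ "aff l 0"])
      show "T (2 * N) \<subseteq> H" by (auto simp: T_def translation_in_H)
      fix x assume "x \<in> H"
      then obtain k b where x: "x = aff (l powi k) b" "b \<in> R" by (auto simp: H_def)
      show "\<exists>h\<in>T (2 * N). \<exists>n::int. x = h ** aff l 0 [^]\<^bsub>Aff\<^esub> n"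
        using x by (intro bexI[of _ "aff 1 b"] exI[of _ k]) (auto simp: T_def aff_0_int_pow)
      fix h assume "h \<in> T (2 * N)"
      then show "x ** h ** inv\<^bsub>Aff\<^esub> x \<in> T (2 * N)"
        using x by (auto simp: T_def inv_aff right_inverse intro: R_mult_powi)
    qed (simp add: generators_in_H)
    then show ?thesis using True by (simp add: F_def)
  next
    case False
    have "T i \<lhd> Aff\<lparr>carrier := T (Suc i)\<rparr> \<and> cyclic_group (Aff\<lparr>carrier := T (Suc i)\<rparr> Mod T i)"
    proof (rule Aff.polycyclic_stepI[OF T T, of _ _ "aff 1 (l ^ i)"])
      show "T i \<subseteq> T (Suc i)" by (force simp: T_def int_span_Suc)
      show "aff 1 (l ^ i) \<in> T (Suc i)" by (auto simp: T_def int_span_power)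
      fix x assume "x \<in> T (Suc i)"
      then obtain y k where x: "x = aff 1 (y + of_int k * l ^ i)" "y \<in> int_span l i"
        by (auto simp: T_def int_span_Suc)
      show "\<exists>h\<in>T i. \<exists>n::int. x = h ** aff 1 (l ^ i) [^]\<^bsub>Aff\<^esub> n"
        using x by (intro bexI[of _ "aff 1 y"] exI[of _ k])
          (auto simp: T_def aff_1_int_pow)
      fix h assume "h \<in> T i"
      then show "x ** h ** inv\<^bsub>Aff\<^esub> x \<in> T i"
        using x by (auto simp: T_def inv_aff)
    qed
    then show ?thesis using False i by (simp add: F_def)
  qed
  have "F 0 = {aff 1 0}" by (simp add: F_def T_def int_span_def)
  moreover have "F (Suc (2 * N)) = H" by (simp add: F_def)
  moreover have "subgroup (F i) \<Gamma>" for i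
    using Aff.subgroup_incl[OF F subgroup_H_Aff FH] .
  ultimately show ?thesis
    unfolding polycyclic_def using step \<Gamma>.is_group
    by (intro conjI exI[of _ "Suc (2 * N)"] exI[of _ F]) (auto simp: less_Suc_eq_le)
qed

text \<open>
  Each term of the lower central series of a subgroup of finite index contains a nonzero
  translation, because commutation with a positive power of \<open>A\<close> in the subgroup multiplies
  translation lengths by \<open>1 - l\<^sup>j \<noteq> 0\<close>.
\<close>

lemma not_virtually_nilpotent_\<Gamma>: "\<not> virtually_nilpotent \<Gamma>"
proof
  assume "virtually_nilpotent \<Gamma>"
  then obtain K m where K: "subgroup K \<Gamma>" "finite (rcosets\<^bsub>\<Gamma>\<^esub> K)"
    and nilp: "lower_central (\<Gamma>\<lparr>carrier := K\<rparr>) m = {\<one>\<^bsub>\<Gamma>\<lparr>carrier := K\<rparr>\<^esub>}"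
    by (auto simp: virtually_nilpotent_def nilpotent_group_def)
  have K_Aff: "subgroup K Aff"
    using Aff.incl_subgroup[OF subgroup_H_Aff K(1)] .
  have pow: "\<exists>j>0. x [^]\<^bsub>Aff\<^esub> (j::nat) \<in> K" if "x \<in> H" for x
    using \<Gamma>.finite_index_imp_power_mem[OF K, of x] that
    by (metis Aff.nat_pow_consistent partial_object.select_convs(1) partial_object.surjective partial_object.update_convs(1))
  obtain j where j: "j > 0" "aff (l ^ j) 0 \<in> K"
    using pow[OF generators_in_H(1)] by (auto simp: aff_0_nat_pow)
  have inv: "inv\<^bsub>\<Gamma>\<lparr>carrier := K\<rparr>\<^esub> x = inv\<^bsub>Aff\<^esub> x" if "x \<in> K" for x
    using Aff.m_inv_consistent[OF K_Aff that] by simp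
  have sub: "lower_central (\<Gamma>\<lparr>carrier := K\<rparr>) k \<subseteq> K" for k
  proof (induction k)
    case (Suc k)
    interpret K: group "\<Gamma>\<lparr>carrier := K\<rparr>"
      using subgroup.subgroup_is_group[OF K(1) \<Gamma>.is_group] .
    have "lower_central (\<Gamma>\<lparr>carrier := K\<rparr>) (Suc k) \<subseteq> carrier (\<Gamma>\<lparr>carrier := K\<rparr>)"
      unfolding lower_central.simps
      by (rule K.generate_incl) (use Suc in \<open>force intro!: K.m_closed[simplified] K.inv_closed[simplified]\<close>)
    then show ?case by simp
  qed simp
  have "\<exists>b\<noteq>0. aff 1 b \<in> lower_central (\<Gamma>\<lparr>carrier := K\<rparr>) k" for k
  proof (induction k)
    case 0
    obtain i :: nat where "i > 0" "aff 1 (of_nat i) \<in> K"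
      using pow[OF generators_in_H(3)] by (auto simp: aff_1_nat_pow)
    then show ?case by (intro exI[of _ "of_nat i"]) simp
  next
    case (Suc k)
    then obtain b where b: "b \<noteq> 0" "aff 1 b \<in> lower_central (\<Gamma>\<lparr>carrier := K\<rparr>) k" by blast
    have "aff 1 (b - l ^ j * b) = aff 1 b \<otimes>\<^bsub>\<Gamma>\<lparr>carrier := K\<rparr>\<^esub> aff (l ^ j) 0
        \<otimes>\<^bsub>\<Gamma>\<lparr>carrier := K\<rparr>\<^esub> inv\<^bsub>\<Gamma>\<lparr>carrier := K\<rparr>\<^esub> aff 1 b
        \<otimes>\<^bsub>\<Gamma>\<lparr>carrier := K\<rparr>\<^esub> inv\<^bsub>\<Gamma>\<lparr>carrier := K\<rparr>\<^esub> aff (l ^ j) 0"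
      using inv[OF j(2)] inv[OF subsetD[OF sub b(2)]] by (simp add: inv_aff)
    also have "\<dots> \<in> lower_central (\<Gamma>\<lparr>carrier := K\<rparr>) (Suc k)"
      by (rule lower_central_SucI[OF b(2)]) (simp add: j)
    finally have "aff 1 (b - l ^ j * b) \<in> lower_central (\<Gamma>\<lparr>carrier := K\<rparr>) (Suc k)" .
    moreover have "b - l ^ j * b \<noteq> 0" using b(1) l_power_neq_1[OF j(1)] by simp
    ultimately show ?case by blast
  qed
  then obtain b where "b \<noteq> 0" "aff 1 b \<in> lower_central (\<Gamma>\<lparr>carrier := K\<rparr>) m" by blast
  then show False unfolding nilp by simp
qed

definition \<Sigma> :: "(complex^2^2) set" where
  "\<Sigma> = {aff 1 0, aff l 0, aff (inverse l) 0, aff 1 1, aff 1 (-1)}"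

lemma \<Sigma>_symmetric_generating: "\<Sigma> \<in> symmetric_generating_sets \<Gamma>"
proof -
  have sub: "\<Sigma> \<subseteq> H"
    using generators_in_H translation_in_H[OF int_span_0] by (auto simp: \<Sigma>_def)
  then have "inv\<^bsub>\<Gamma>\<^esub> s = inv\<^bsub>Aff\<^esub> s" if "s \<in> \<Sigma>" for s
    using Aff.m_inv_consistent[OF subgroup_H_Aff] that by auto
  then have "inv\<^bsub>\<Gamma>\<^esub> s \<in> \<Sigma>" if "s \<in> \<Sigma>" for s
    using that by (auto simp: \<Sigma>_def inv_aff)
  moreover have "generate \<Gamma> \<Sigma> = H"
    using sub by (rule generate_eq_H) (auto simp: \<Sigma>_def)
  ultimately show ?thesis
    using sub by (auto simp: symmetric_generating_sets_def \<Sigma>_def)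
qed

lemma products_upto_\<Sigma>:
  assumes "x \<in> products_upto \<Gamma> \<Sigma> m"
  obtains k b where "x = aff (l powi k) b" "\<bar>k\<bar> \<le> int m"
proof -
  obtain ws where ws: "x = word_prod \<Gamma> ws" "set ws \<subseteq> \<Sigma>" "length ws \<le> m"
    using assms by (auto simp: products_upto_def)
  have "\<exists>k b. word_prod \<Gamma> ws = aff (l powi k) b \<and> \<bar>k\<bar> \<le> int (length ws)"
    using ws(2)
  proof (induction ws)
    case Nil
    then show ?case by (intro exI[of _ 0]) (simp add: word_prod_def)
  next
    case (Cons s ws)
    then obtain k b where k: "word_prod \<Gamma> ws = aff (l powi k) b" "\<bar>k\<bar> \<le> int (length ws)" by auto
    have "\<exists>e\<in>{-1,0,1}. \<exists>c. s = aff (l powi e) c"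
      using Cons.prems by (auto simp: \<Sigma>_def power_int_minus)
    then obtain e c where e: "s = aff (l powi e) c" "e \<in> {-1, 0, 1}" by blast
    then have "\<bar>e\<bar> \<le> 1" by auto
    moreover note e(1)
    moreover have "word_prod \<Gamma> (s # ws) = s ** word_prod \<Gamma> ws" by (simp add: word_prod_def)
    ultimately show ?case using k by (intro exI[of _ "e + k"]) (auto simp: power_int_add)
  qed
  then show ?thesis using ws that by force
qed

text \<open>
  If \<open>\<bar>k\<bar> q = N\<close>, then the \<open>q\<close>-th power has the multiplier \<open>l\<^sup>k\<^sup>q\<close>, which is \<open>l\<^sup>N\<close> or its inverse.
\<close>

lemma power_has_golden_multiplier:
  assumes "k = 0 \<or> \<bar>k\<bar> dvd int N"
  obtains p :: nat and a c where "p > 0" "a \<in> {1, l ^ N, inverse (l ^ N)}"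
    "aff (l powi k) b [^]\<^bsub>Aff\<^esub> p = aff a c"
proof (cases "k = 0")
  case True
  then show ?thesis using that[of 1 1 b] by simp
next
  case False
  then obtain q where q: "int N = \<bar>k\<bar> * q" using assms unfolding dvd_def by blast
  then have "q > 0" using N_pos False by (metis abs_ge_zero mult_nonneg_nonpos not_le of_nat_0_less_iff)
  then have kq: "k * q = int N \<or> k * q = - int N" using q by (auto simp: abs_if split: if_splits)
  obtain c where c: "aff (l powi k) b [^]\<^bsub>Aff\<^esub> nat q = aff ((l powi k) ^ nat q) c"
    using aff_nat_pow by blast
  have "(l powi k) ^ nat q = l powi (k * q)" using \<open>q > 0\<close> by (simp add: power_int_power')
  then have "(l powi k) ^ nat q \<in> {1, l ^ N, inverse (l ^ N)}" using kq by (auto simp: power_int_minus)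
  then show ?thesis using that[OF _ _ c] \<open>q > 0\<close> by simp
qed

lemma not_positively_independent_\<Gamma>:
  assumes "k = 0 \<or> \<bar>k\<bar> dvd int N" "j = 0 \<or> \<bar>j\<bar> dvd int N"
  shows "\<not> positively_independent \<Gamma> (aff (l powi k) b) (aff (l powi j) c)"
proof
  assume "positively_independent \<Gamma> (aff (l powi k) b) (aff (l powi j) c)"
  then have pi: "positively_independent Aff (aff (l powi k) b) (aff (l powi j) c)"
    by (auto simp: positively_independent_def)
  obtain p a b' where p: "p > 0" "a \<in> {1, l ^ N, inverse (l ^ N)}"
    "aff (l powi k) b [^]\<^bsub>Aff\<^esub> (p::nat) = aff a b'"
    using power_has_golden_multiplier[OF assms(1)] by metis
  obtain q d c' where q: "q > 0" "d \<in> {1, l ^ N, inverse (l ^ N)}"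
    "aff (l powi j) c [^]\<^bsub>Aff\<^esub> (q::nat) = aff d c'"
    using power_has_golden_multiplier[OF assms(2)] by metis
  have "(l ^ N)\<^sup>2 = l ^ N + 1" using golden by (simp add: mult.commute flip: power_mult)
  then have "\<not> positively_independent Aff (aff a b') (aff d c')"
    using p(2) q(2) by (rule golden_not_positively_independent)
  then show False using Aff.positively_independent_powers[OF pi p(1) q(1)] p(3) q(3) by simp
qed

end

lemma exists_golden_root:
  assumes "N > 0"
  shows "\<exists>l. golden_root l N"
proof -
  let ?\<phi> = "(1 + sqrt 5) / 2 :: real"
  let ?l = "root N ?\<phi>"
  have phi: "?\<phi> ^ 2 = ?\<phi> + 1" "?\<phi> > 1" by (simp_all add: power2_eq_square field_simps)
  have l: "?l ^ N = ?\<phi>" using assms phi by (simp add: real_root_pow_pos2)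
  have "?l ^ (2 * N) = ?l ^ N + 1" using phi(1) l by (metis mult.commute power_mult)
  moreover have "?l > 1" using assms phi(2) by simp
  ultimately obtain r :: real where r: "r ^ (2 * N) = r ^ N + 1" "r > 1" by blast
  have "golden_root (complex_of_real r) N"
  proof
    show "complex_of_real r ^ (2 * N) = complex_of_real r ^ N + 1"
      using r(1) by (metis of_real_1 of_real_add of_real_power)
  qed (use assms r in simp_all)
  then show ?thesis by blast
qed

theorem theorem1p7:
  fixes n :: nat
  assumes "n \<ge> 1"
  shows "\<exists>H \<Gamma>. subgroup H (affine_group algebraic_numbers) \<and>
           \<Gamma> = (affine_group algebraic_numbers)\<lparr>carrier := H\<rparr> \<and>
           two_generated \<Gamma> \<and> polycyclic \<Gamma> \<and>
           subgroup H (GL2 algebraic_numbers) \<and> metabelian \<Gamma> \<and>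
           d_plus_group \<Gamma> \<ge> enat n \<and>
           \<not> virtually_nilpotent \<Gamma>"
proof -
  \<comment> \<open>Every nonzero exponent of absolute value below \<open>n\<close> divides \<open>n!\<close>.\<close>
  obtain l where "golden_root l (fact n)" using exists_golden_root[of "fact n"] by auto
  then interpret golden_root l "fact n" .
  have "n \<le> m" if xy: "x \<in> products_upto \<Gamma> \<Sigma> m" "y \<in> products_upto \<Gamma> \<Sigma> m"
    "positively_independent \<Gamma> x y" for m x y
  proof (rule ccontr)
    assume "\<not> n \<le> m"
    then have dvd: "k = 0 \<or> \<bar>k\<bar> dvd int (fact n)" if "\<bar>k\<bar> \<le> int m" for k
      using that dvd_fact[of "nat \<bar>k\<bar>" n] by (cases "k = 0") (auto simp: nat_dvd_iff)
    obtain k b j c where "x = aff (l powi k) b" "\<bar>k\<bar> \<le> int m" "y = aff (l powi j) c" "\<bar>j\<bar> \<le> int m"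
      using products_upto_\<Sigma>[OF xy(1)] products_upto_\<Sigma>[OF xy(2)] by metis
    then show False using not_positively_independent_\<Gamma> dvd xy(3) by metis
  qed
  then have "enat n \<le> d_plus \<Gamma> \<Sigma>"
    unfolding d_plus_def by (auto simp: le_Inf_iff)
  then have "enat n \<le> d_plus_group \<Gamma>"
    unfolding d_plus_group_def using \<Sigma>_symmetric_generating by (rule SUP_upper2[rotated])
  moreover have "\<Gamma> = (affine_group algebraic_numbers)\<lparr>carrier := H\<rparr>"
    by (simp add: affine_group_def)
  ultimately show ?thesis
    using subgroup_H_algebraic two_generated_\<Gamma> polycyclic_\<Gamma> not_virtually_nilpotent_\<Gamma>
      metabelian_subgroup_Aff[OF subgroup_H_Aff]
    by (intro exI[of _ H] exI[of _ \<Gamma>] conjI)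
qed

end
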